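(* The function $$(1^n\,0\,1^r\,0\,1^{a_1}\,0\,1^{a_2}\,0\,\cdots\,0\,1^{a_k})\ \mapsto\ \mathrm{coeff}_{q^r}\binom{n}{a_1,a_2,\ldots,a_k}_{\!q},$$ giving the coefficient at $q^r$ in the $q$-multinomial coefficient, is in $\#\mathsf{L}$.
   Context: Define the $q$-integer $(n)_q=(1-q^n)/(1-q)$, the $q$-factorial $(n)_q!=(n)_q(n-1)_q\cdots(1)_q$, the $q$-binomial $\binom{n+m}{n}_{q}=\frac{(n+m)_q!}{(n)_q!\,(m)_q!}$, and the $q$-multinomial $\binom{n}{a_1,\ldots,a_k}_{q}=\binom{n}{a_1}_{q}\binom{n-a_1}{a_2}_{q}\binom{n-a_1-a_2}{a_3}_q\cdots$, for non-negative integers $a_1,\dots,a_k$ with $a_1+\cdots+a_k=n$. It is a polynomial in $q$, and $\mathrm{coeff}_{q^r}$ extracts the coefficient of $q^r$. The number $k$ is part of the input (not fixed). The alphabet is $\Sigma=\{0,1\}$; $1^a$ is the string of $a$ ones and juxtaposition is concatenation. A function given only on strings of a displayed form is extended by $0$ to all other strings. $\#\mathsf{L}$ is the class of functions $f:\Sigma^*\to\mathbb{N}_0$ such that $f(x)$ is the number of accepting computation paths on input $x$ of a fixed nondeterministic Turing machine with read-only input tape that uses $O(\log|x|)$ work space and halts on every computation path. Equivalently: there are a polynomial $p$ and a deterministic $O(\log|x|)$-space Turing machine $M$ with an additional read-once, left-to-right witness tape such that $f(x)=\#\{w\in\Sigma^{p(|x|)}\mid M(x,w)=\mathsf{yes}\}$.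 *)

theory Defs
  imports
    "HOL-Computational_Algebra.Computational_Algebra"
    "HOL-Library.Landau_Symbols"
begin

section \<open>Nondeterministic Turing machines with a read-only input tape\<close>

text \<open>
  An input word \<open>x :: bool list\<close> (\<open>True\<close> is the letter 1) is written on the cells
  \<open>1, \<dots>, length x\<close> of the input tape, between end markers in the cells \<open>0\<close> and
  \<open>length x + 1\<close>.
\<close>

datatype input_symbol = LeftEnd | Letter bool | RightEnd

definition input_symbol :: "bool list \<Rightarrow> nat \<Rightarrow> input_symbol" where
  "input_symbol x i =
     (if i = 0 then LeftEnd else if i \<le> length x then Letter (x ! (i - 1)) else RightEnd)"

datatype direction = MoveLeft | Stay | MoveRight

text \<open>The cells of a tape are numbered from 0. A left move in cell 0 has no effect.\<close>

fun move :: "direction \<Rightarrow> nat \<Rightarrow> nat" where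
  "move MoveLeft i = i - 1"
| "move Stay i = i"
| "move MoveRight i = Suc i"

text \<open>
  A transition \<open>(p, a, bs, p', d, acts)\<close> is applicable in state \<open>p\<close> if the input head scans
  \<open>a\<close> and the heads of the work tapes scan the symbols \<open>bs\<close> (one for each work tape). It changes
  the state to \<open>p'\<close>, moves the input head in direction \<open>d\<close>, and \<open>acts\<close> gives for each work tape
  the symbol to be written and the direction of the subsequent head move.
\<close>

type_synonym ('q, 's) transition =
  "'q \<times> input_symbol \<times> 's list \<times> 'q \<times> direction \<times> ('s \<times> direction) list"

record ('q, 's) ntm =
  num_tapes :: nat
  states :: "'q set"
  alphabet :: "'s set"
  blank :: 's
  start :: 'q
  accepting :: "'q set"
  transitions :: "('q, 's) transition set"

definition wf_ntm :: "('q, 's) ntm \<Rightarrow> bool" where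
  "wf_ntm M \<longleftrightarrow>
     finite (states M) \<and> finite (alphabet M) \<and> blank M \<in> alphabet M \<and>
     start M \<in> states M \<and> accepting M \<subseteq> states M \<and>
     (\<forall>(p, a, bs, p', d, acts) \<in> transitions M.
        p \<in> states M \<and> p' \<in> states M \<and>
        length bs = num_tapes M \<and> set bs \<subseteq> alphabet M \<and>
        length acts = num_tapes M \<and> fst ` set acts \<subseteq> alphabet M)"

text \<open>A work tape is its content together with the position of its head.\<close>

type_synonym 's tape = "(nat \<Rightarrow> 's) \<times> nat"

fun tape_read :: "'s tape \<Rightarrow> 's" where
  "tape_read (t, h) = t h"

fun tape_act :: "'s tape \<Rightarrow> 's \<times> direction \<Rightarrow> 's tape" where
  "tape_act (t, h) (b, d) = (t(h := b), move d h)"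

text \<open>A configuration consists of the state, the input head position and the work tapes.\<close>

type_synonym ('q, 's) config = "'q \<times> nat \<times> 's tape list"

definition init_config :: "('q, 's) ntm \<Rightarrow> ('q, 's) config" where
  "init_config M = (start M, 0, replicate (num_tapes M) (\<lambda>_. blank M, 0))"

text \<open>
  The input head cannot leave the region delimited by the end markers (otherwise its position
  would provide additional storage).
\<close>

inductive ntm_step :: "('q, 's) ntm \<Rightarrow> bool list \<Rightarrow> ('q, 's) config \<Rightarrow> ('q, 's) config \<Rightarrow> bool"
  for M :: "('q, 's) ntm" and x :: "bool list" where
  "(p, input_symbol x i, map tape_read ts, p', d, acts) \<in> transitions M \<Longrightarrow>
   ntm_step M x (p, i, ts) (p', min (move d i) (length x + 1), map2 tape_act ts acts)"

definition halted :: "('q, 's) ntm \<Rightarrow> bool list \<Rightarrow> ('q, 's) config \<Rightarrow> bool" where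
  "halted M x c \<longleftrightarrow> (\<nexists>c'. ntm_step M x c c')"

definition accepting_paths :: "('q, 's) ntm \<Rightarrow> bool list \<Rightarrow> ('q, 's) config list set" where
  "accepting_paths M x =
     {cs. cs \<noteq> [] \<and> hd cs = init_config M \<and> successively (ntm_step M x) cs \<and>
          halted M x (last cs) \<and> fst (last cs) \<in> accepting M}"

definition halts_on_all_paths :: "('q, 's) ntm \<Rightarrow> bool list \<Rightarrow> bool" where
  "halts_on_all_paths M x \<longleftrightarrow>
     (\<nexists>cs :: nat \<Rightarrow> ('q, 's) config.
        cs 0 = init_config M \<and> (\<forall>i. ntm_step M x (cs i) (cs (Suc i))))"

text \<open>
  The machine never visits a cell with number \<open>\<ge> m\<close> on any of its work tapes.
\<close>

definition space_bounded :: "('q, 's) ntm \<Rightarrow> bool list \<Rightarrow> nat \<Rightarrow> bool" where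
  "space_bounded M x m \<longleftrightarrow>
     (\<forall>p i ts. (ntm_step M x)\<^sup>*\<^sup>* (init_config M) (p, i, ts) \<longrightarrow> (\<forall>(t, h) \<in> set ts. h < m))"

text \<open>
  As state sets and work alphabets are finite, taking states and symbols to be natural numbers
  is no restriction.
\<close>

definition sharpL :: "(bool list \<Rightarrow> nat) set" where
  "sharpL =
     {f. \<exists>M :: (nat, nat) ntm. wf_ntm M \<and>
         (\<forall>x. halts_on_all_paths M x) \<and>
         (\<exists>s :: nat \<Rightarrow> nat. (\<lambda>n. real (s n)) \<in> O(\<lambda>n. ln (real n)) \<and>
            (\<forall>x. space_bounded M x (s (length x)))) \<and>
         (\<forall>x. f x = card (accepting_paths M x))}"

text \<open>
  The lemma \<open>finite_accepting_paths\<close> shows that the cardinality in the definition of \<open>sharpL\<close>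
  is always that of a finite set.
\<close>

lemma finite_ntm_step:
  assumes "wf_ntm M"
  shows "finite {c'. ntm_step M x c c'}"
proof -
  have "transitions M \<subseteq> states M \<times> {LeftEnd, Letter True, Letter False, RightEnd} \<times>
          {bs. set bs \<subseteq> alphabet M \<and> length bs = num_tapes M} \<times> states M \<times>
          {MoveLeft, Stay, MoveRight} \<times>
          {acts. set acts \<subseteq> alphabet M \<times> {MoveLeft, Stay, MoveRight} \<and> length acts = num_tapes M}"
    (is "_ \<subseteq> ?T")
  proof
    fix t assume t: "t \<in> transitions M"
    obtain p a bs p' d acts where [simp]: "t = (p, a, bs, p', d, acts)"
      by (cases t) auto
    have a: "a \<in> {LeftEnd, Letter True, Letter False, RightEnd}"
      by (cases a) auto
    have d: "e \<in> {MoveLeft, Stay, MoveRight}" for e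
      by (cases e) auto
    have w: "p \<in> states M \<and> p' \<in> states M \<and> length bs = num_tapes M \<and> set bs \<subseteq> alphabet M \<and>
        length acts = num_tapes M \<and> fst ` set acts \<subseteq> alphabet M"
      using assms t unfolding wf_ntm_def by fastforce
    have "set acts \<subseteq> alphabet M \<times> {MoveLeft, Stay, MoveRight}"
      using w d by force
    then show "t \<in> ?T"
      using w a d[of d] by simp
  qed
  moreover have "finite ?T"
    using assms unfolding wf_ntm_def
    by (intro finite_cartesian_product finite_lists_length_eq) auto
  ultimately have fin: "finite (transitions M)"
    by (rule finite_subset)
  obtain p i ts where c: "c = (p, i, ts)"
    by (cases c) auto
  have "{c'. ntm_step M x c c'} \<subseteq>
      (\<lambda>(p, a, bs, p', d, acts). (p', min (move d i) (length x + 1), map2 tape_act ts acts)) `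
        transitions M"
    unfolding c by (auto elim!: ntm_step.cases intro!: rev_image_eqI)
  then show ?thesis
    by (rule finite_subset) (use fin in simp)
qed

lemma finite_accepting_paths:
  assumes wf: "wf_ntm M" and halts: "halts_on_all_paths M x"
  shows "finite (accepting_paths M x)"
proof -
  let ?R = "(ntm_step M x)\<^sup>*\<^sup>* (init_config M)"
  define P where "P c = {cs. cs \<noteq> [] \<and> hd cs = c \<and> successively (ntm_step M x) cs \<and>
    halted M x (last cs)}" for c
  have "wf {(c', c). ?R c \<and> ntm_step M x c c'}"
    unfolding wf_iff_no_infinite_down_chain
  proof safe
    fix f assume f: "\<forall>i. (f (Suc i), f i) \<in> {(c', c). ?R c \<and> ntm_step M x c c'}"
    then have "?R (f 0)" by simp
    then obtain n where "(ntm_step M x ^^ n) (init_config M) (f 0)"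
      by (auto simp: rtranclp_power)
    then obtain g where g: "g 0 = init_config M" "g n = f 0"
        "\<And>i. i < n \<Longrightarrow> ntm_step M x (g i) (g (Suc i))"
      unfolding relpowp_fun_conv by blast
    define h where "h i = (if i \<le> n then g i else f (i - n))" for i
    have "ntm_step M x (h i) (h (Suc i))" for i
    proof (cases "i < n")
      case True
      then show ?thesis using g by (simp add: h_def)
    next
      case False
      then have "h i = f (i - n)" "h (Suc i) = f (Suc (i - n))"
        using g by (auto simp: h_def Suc_diff_le)
      then show ?thesis using f by auto
    qed
    moreover have "h 0 = init_config M"
      using g by (simp add: h_def)
    ultimately show False
      using halts unfolding halts_on_all_paths_def by blast
  qed
  then have "?R c \<longrightarrow> finite (P c)" for c
  proof (induction c rule: wf_induct_rule)
    case (less c)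
    show ?case
    proof
      assume c: "?R c"
      have "P c \<subseteq> insert [c] (\<Union>c' \<in> {c'. ntm_step M x c c'}. (#) c ` P c')"
      proof
        fix cs assume cs: "cs \<in> P c"
        then obtain ds where ds: "cs = c # ds"
          unfolding P_def by (cases cs) auto
        show "cs \<in> insert [c] (\<Union>c' \<in> {c'. ntm_step M x c c'}. (#) c ` P c')"
        proof (cases ds)
          case Nil
          then show ?thesis using ds by simp
        next
          case (Cons c' es)
          then have "ntm_step M x c c'" "ds \<in> P c'"
            using cs ds unfolding P_def by auto
          then show ?thesis using ds by blast
        qed
      qed
      moreover have "finite (P c')" if "ntm_step M x c c'" for c'
        using less[of c'] c that by (auto intro: rtranclp.rtrancl_into_rtrancl)
      ultimately show "finite (P c)"
        using finite_ntm_step[OF wf, of x c] by (auto elim!: finite_subset)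
    qed
  qed
  then have "finite (P (init_config M))"
    by blast
  then show ?thesis
    by (rule rev_finite_subset) (auto simp: accepting_paths_def P_def)
qed


section \<open>\<open>q\<close>-analogues\<close>

text \<open>The quotients are formed in the field of fractions of the polynomial ring in \<open>q\<close>.\<close>

type_synonym ratfun = "int poly fract"

definition qvar :: ratfun where
  "qvar = to_fract [:0, 1:]"

definition q_int :: "nat \<Rightarrow> ratfun" where
  "q_int n = (1 - qvar ^ n) / (1 - qvar)"

definition q_fact :: "nat \<Rightarrow> ratfun" where
  "q_fact n = (\<Prod>i = 1..n. q_int i)"

text \<open>Only meant for \<open>k \<le> n\<close>.\<close>

definition q_binomial :: "nat \<Rightarrow> nat \<Rightarrow> ratfun" where
  "q_binomial n k = q_fact n / (q_fact k * q_fact (n - k))"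

text \<open>Only meant for lists with \<open>sum_list as = n\<close>.\<close>

fun q_multinomial :: "nat \<Rightarrow> nat list \<Rightarrow> ratfun" where
  "q_multinomial n [] = 1"
| "q_multinomial n (a # as) = q_binomial n a * q_multinomial (n - a) as"

text \<open>
  The coefficient of \<open>q ^ r\<close> in a rational function that is a polynomial. The lemma
  \<open>q_multinomial_polynomial\<close> below shows that the \<open>q\<close>-multinomials are polynomials, and that
  their coefficients are not negative.
\<close>

definition q_coeff :: "ratfun \<Rightarrow> nat \<Rightarrow> int" where
  "q_coeff F r = coeff (THE P. to_fract P = F) r"

lemma q_coeff_to_fract [simp]: "q_coeff (to_fract P) r = coeff P r"
  by (simp add: q_coeff_def)

fun q_binomial_poly :: "nat \<Rightarrow> nat \<Rightarrow> int poly" where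
  "q_binomial_poly n 0 = 1"
| "q_binomial_poly 0 (Suc k) = 0"
| "q_binomial_poly (Suc n) (Suc k) =
     q_binomial_poly n k + monom 1 (Suc k) * q_binomial_poly n (Suc k)"

lemma q_binomial_poly_eq_0: "n < k \<Longrightarrow> q_binomial_poly n k = 0"
  by (induction n k rule: q_binomial_poly.induct) auto

lemma to_fract_monom: "to_fract (monom 1 n) = qvar ^ n"
proof (induction n)
  case (Suc n)
  have "monom (1 :: int) (Suc n) = [:0, 1:] * monom 1 n"
    by (simp add: monom_Suc)
  then show ?case
    using Suc by (simp add: qvar_def del: mult_pCons_left)
qed simp

lemma qvar_power_neq_1:
  assumes "n > 0"
  shows "qvar ^ n \<noteq> 1"
proof
  assume "qvar ^ n = 1"
  then have "to_fract (monom 1 n :: int poly) = to_fract 1"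
    by (simp add: to_fract_monom)
  then have "monom (1 :: int) n = 1"
    by (simp only: to_fract_eq_iff)
  then have "degree (monom (1 :: int) n) = 0"
    by (simp only: degree_1)
  then show False
    using assms by (simp add: degree_monom_eq)
qed

lemma q_int_nonzero: "n > 0 \<Longrightarrow> q_int n \<noteq> 0"
  using qvar_power_neq_1[of n] qvar_power_neq_1[of 1] by (simp add: q_int_def)

lemma q_fact_nonzero: "q_fact n \<noteq> 0"
  by (auto simp: q_fact_def q_int_nonzero)

lemma q_fact_0 [simp]: "q_fact 0 = 1"
  by (simp add: q_fact_def)

lemma q_fact_Suc: "q_fact (Suc n) = q_int (Suc n) * q_fact n"
  by (simp add: q_fact_def mult.commute)

lemma q_int_add: "q_int (m + n) = q_int m + qvar ^ m * q_int n"
  using qvar_power_neq_1[of 1] by (simp add: q_int_def field_simps power_add)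

lemma q_binomial_Suc_Suc:
  assumes "k < n"
  shows "q_binomial (Suc n) (Suc k) = q_binomial n k + qvar ^ Suc k * q_binomial n (Suc k)"
proof -
  obtain d where n: "n = Suc (k + d)"
    using assms less_iff_Suc_add by blast
  have i: "q_int (Suc n) = q_int (Suc k) + qvar ^ Suc k * q_int (Suc d)"
    using q_int_add[of "Suc k" "Suc d"] by (simp add: n)
  have "q_binomial (Suc n) (Suc k) =
      (q_int (Suc k) + qvar ^ Suc k * q_int (Suc d)) * q_fact n /
      ((q_int (Suc k) * q_fact k) * (q_int (Suc d) * q_fact d))"
    by (simp only: q_binomial_def q_fact_Suc[of n] i) (simp add: n q_fact_Suc)
  also have "\<dots> = q_fact n / (q_fact k * (q_int (Suc d) * q_fact d)) +
      qvar ^ Suc k * (q_fact n / ((q_int (Suc k) * q_fact k) * q_fact d))"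
    using q_int_nonzero[of "Suc k"] q_int_nonzero[of "Suc d"] q_fact_nonzero[of k]
      q_fact_nonzero[of d]
    by (simp add: divide_simps del: power_Suc) (simp add: algebra_simps)
  also have "\<dots> = q_binomial n k + qvar ^ Suc k * q_binomial n (Suc k)"
    by (simp add: q_binomial_def n q_fact_Suc Suc_diff_le)
  finally show ?thesis .
qed

lemma to_fract_q_binomial_poly: "k \<le> n \<Longrightarrow> to_fract (q_binomial_poly n k) = q_binomial n k"
proof (induction n k rule: q_binomial_poly.induct)
  case (1 n)
  then show ?case using q_fact_nonzero by (simp add: q_binomial_def)
next
  case (3 n k)
  show ?case
  proof (cases "k = n")
    case True
    have "q_binomial m m = 1" for m
      using q_fact_nonzero by (simp add: q_binomial_def)
    then show ?thesis using True 3 by (simp add: q_binomial_poly_eq_0)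
  next
    case False
    then show ?thesis using 3 by (simp add: q_binomial_Suc_Suc to_fract_monom del: power_Suc)
  qed
qed simp

lemma coeff_mult_nonneg:
  fixes P Q :: "int poly"
  assumes "\<And>r. coeff P r \<ge> 0" "\<And>r. coeff Q r \<ge> 0"
  shows "coeff (P * Q) r \<ge> 0"
  unfolding coeff_mult by (intro sum_nonneg mult_nonneg_nonneg assms)

lemma coeff_q_binomial_poly_nonneg: "coeff (q_binomial_poly n k) r \<ge> 0"
proof (induction n k arbitrary: r rule: q_binomial_poly.induct)
  case (3 n k)
  have "coeff (monom 1 (Suc k) * q_binomial_poly n (Suc k)) r \<ge> 0"
    by (rule coeff_mult_nonneg) (use 3 in auto)
  then show ?case using 3 by simp
qed (simp_all add: coeff_1)

lemma q_multinomial_polynomial: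
  assumes "sum_list as = n"
  shows "\<exists>P. to_fract P = q_multinomial n as \<and> (\<forall>r. coeff P r \<ge> 0)"
  using assms
proof (induction as arbitrary: n)
  case Nil
  show ?case by (rule exI[of _ 1]) (simp add: coeff_1)
next
  case (Cons a as)
  then obtain P where "to_fract P = q_multinomial (n - a) as" "\<forall>r. coeff P r \<ge> 0"
    by (metis add_diff_cancel_left' sum_list.Cons)
  moreover have "a \<le> n" using Cons.prems by simp
  ultimately show ?case
    by (intro exI[of _ "q_binomial_poly n a * P"])
      (auto simp: to_fract_q_binomial_poly intro!: coeff_mult_nonneg coeff_q_binomial_poly_nonneg)
qed


section \<open>The function on words\<close>

definition ones :: "nat \<Rightarrow> bool list" where
  "ones a = replicate a True"

definition encode :: "nat \<Rightarrow> nat \<Rightarrow> nat list \<Rightarrow> bool list" where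
  "encode n r as = ones n @ [False] @ ones r @ concat (map (\<lambda>a. [False] @ ones a) as)"

text \<open>
  The lemma \<open>encode_inject\<close> shows that \<open>n\<close>, \<open>r\<close> and \<open>as\<close> are determined by the word.
\<close>

definition q_multinomial_fun :: "bool list \<Rightarrow> nat" where
  "q_multinomial_fun x =
     (if \<exists>n r as. as \<noteq> [] \<and> sum_list as = n \<and> x = encode n r as
      then THE c. \<exists>n r as. as \<noteq> [] \<and> sum_list as = n \<and> x = encode n r as \<and>
                     int c = q_coeff (q_multinomial n as) r
      else 0)"

lemma concat_ones_inject:
  "concat (map (\<lambda>a. [False] @ ones a) as) = concat (map (\<lambda>a. [False] @ ones a) bs) \<longleftrightarrow> as = bs"
proof (induction as arbitrary: bs)
  case Nil
  then show ?case by (cases bs) auto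
next
  case (Cons a as)
  let ?g = "\<lambda>as. concat (map (\<lambda>a. [False] @ ones a) as)"
  have tw: "takeWhile id (ones a @ ?g as) = ones a" for a as
    by (cases as) (auto simp: ones_def takeWhile_append)
  show ?case
  proof (cases bs)
    case (Cons b bs')
    have "ones a @ ?g as = ones b @ ?g bs' \<longleftrightarrow> a = b \<and> as = bs'"
    proof
      assume eq: "ones a @ ?g as = ones b @ ?g bs'"
      then have "ones a = ones b" by (metis tw)
      then show "a = b \<and> as = bs'"
        using eq Cons.IH by (auto simp: ones_def dest: arg_cong[where f = length])
    qed simp
    then show ?thesis using Cons by simp
  qed simp
qed

lemma encode_inject: "encode n r as = encode n' r' as' \<longleftrightarrow> n = n' \<and> r = r' \<and> as = as'"
proof -
  have "[False] @ encode n r as = concat (map (\<lambda>a. [False] @ ones a) (n # r # as))" for n r as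
    by (simp add: encode_def)
  then have "encode n r as = encode n' r' as' \<longleftrightarrow> n # r # as = n' # r' # as'"
    using concat_ones_inject by (metis same_append_eq)
  then show ?thesis by simp
qed

lemma q_multinomial_fun_encode:
  assumes "as \<noteq> []" "sum_list as = n"
  shows "int (q_multinomial_fun (encode n r as)) = q_coeff (q_multinomial n as) r"
proof -
  obtain P where "to_fract P = q_multinomial n as" "\<forall>r. coeff P r \<ge> 0"
    using q_multinomial_polynomial assms(2) by blast
  then have nonneg: "q_coeff (q_multinomial n as) r \<ge> 0"
    by (metis q_coeff_to_fract)
  have "q_multinomial_fun (encode n r as) = (THE c. int c = q_coeff (q_multinomial n as) r)"
    using assms unfolding q_multinomial_fun_def encode_inject by auto
  also have "\<dots> = nat (q_coeff (q_multinomial n as) r)"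
    using nonneg by (intro the_equality) auto
  finally show ?thesis using nonneg by simp
qed

lemma q_multinomial_fun_other:
  "(\<nexists>n r as. as \<noteq> [] \<and> sum_list as = n \<and> x = encode n r as) \<Longrightarrow> q_multinomial_fun x = 0"
  unfolding q_multinomial_fun_def by (rule if_not_P)

end

theory Submission
  imports
    Defs
    "HOL-Library.Countable"
    "HOL-Library.Log_Nat"
    "HOL-Real_Asymp.Real_Asymp"
begin

text \<open>
  The \<open>q\<close>-multinomial coefficient is the product of the \<open>q\<close>-binomial coefficients of
  \<open>n - a\<^sub>1 - \<dots> - a\<^bsub>i-1\<^esub>\<close> over \<open>a\<^sub>i\<close>. The \<open>q\<close>-binomial coefficient of \<open>N\<close> over \<open>a\<close> is the
  generating function of the binary words with \<open>a\<close> ones and \<open>N - a\<close> zeros, where a word has the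
  weight \<open>q ^ e\<close> and \<open>e\<close> is the sum over all ones of the number of zeros to the left of that one.
  So the coefficient of \<open>q ^ r\<close> in the \<open>q\<close>-multinomial counts the sequences of such words, one for
  each \<open>a\<^sub>i\<close>, whose exponents add up to \<open>r\<close>.

  A machine guesses these words letter by letter while its input head passes over the blocks
  \<open>1 ^ a\<^sub>i\<close>. It only needs the number \<open>m\<close> of letters that are still to be guessed in the current
  word, the number \<open>z\<close> of zeros guessed so far in this word, the part of \<open>r\<close> that is not yet used
  up, and an auxiliary counter. The remaining ones of the current word are those of the block to the
  right of the head. A guessed one moves the head and subtracts \<open>z\<close> from \<open>r\<close>; a guessed zero
  increments \<open>z\<close>. At the end of a block the letters not yet guessed have to be zeros, and the
  length of the next word is the number of zeros \<open>m + z\<close>. If \<open>F(m, k, z)\<close> is the generating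
  function of the guesses for \<open>k\<close> remaining ones, then
  \<open>F(m + 1, k + 1, z) = q ^ z * F(m, k, z) + F(m, k + 1, z + 1)\<close>, whose solution is
  \<open>q ^ (k * z)\<close> times the \<open>q\<close>-binomial coefficient of \<open>m\<close> over \<open>k\<close>: this is
  \<open>count_blocks_ones\<close>.

  All counters are bounded by the length of the input, hence they fit in binary on work tapes of
  logarithmic length. Increments and decrements of binary counters are deterministic subroutines
  of the Turing machine, so that they do not change the number of accepting paths. The machine is
  obtained by compiling a program whose instructions are increments, decrements with zero test,
  and nondeterministic branches on the scanned input symbol; the lemmas \<open>computes_Incr\<close>,
  \<open>computes_Decr_Suc\<close>, \<open>computes_Decr_0\<close>, \<open>computes_Branch\<close> and \<open>computes_Branch2\<close> reduce
  statements about the machine to statements about the program.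
\<close>

section \<open>Counting accepting paths by recursion along the computation tree\<close>

definition heads_below :: "nat \<Rightarrow> ('q, 's) config \<Rightarrow> bool" where
  "heads_below b c \<longleftrightarrow> (\<forall>(t, h) \<in> set (snd (snd c)). h < b)"

text \<open>
  \<open>path_count M x b c v\<close> says that all computations from the configuration \<open>c\<close> halt, that they
  visit only configurations in which all work heads are below \<open>b\<close>, and that exactly \<open>v\<close> of them
  are accepting. As the definition is inductive, it deals with termination, the space bound
  and the number of accepting paths at the same time.
\<close>

inductive path_count ::
  "('q, 's) ntm \<Rightarrow> bool list \<Rightarrow> nat \<Rightarrow> ('q, 's) config \<Rightarrow> nat \<Rightarrow> bool"
  for M :: "('q, 's) ntm" and x :: "bool list" and b :: nat where
  halt: "halted M x c \<Longrightarrow> heads_below b c \<Longrightarrow>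
    path_count M x b c (if fst c \<in> accepting M then 1 else 0)"
| step: "\<not> halted M x c \<Longrightarrow> heads_below b c \<Longrightarrow> finite {c'. ntm_step M x c c'} \<Longrightarrow>
    (\<And>c'. ntm_step M x c c' \<Longrightarrow> path_count M x b c' (g c')) \<Longrightarrow>
    path_count M x b c (\<Sum>c' | ntm_step M x c c'. g c')"

definition accepting_paths_from ::
  "('q, 's) ntm \<Rightarrow> bool list \<Rightarrow> ('q, 's) config \<Rightarrow> ('q, 's) config list set" where
  "accepting_paths_from M x c =
     {cs. cs \<noteq> [] \<and> hd cs = c \<and> successively (ntm_step M x) cs \<and>
          halted M x (last cs) \<and> fst (last cs) \<in> accepting M}"

lemma accepting_paths_from_halted:
  assumes "halted M x c"
  shows "accepting_paths_from M x c = (if fst c \<in> accepting M then {[c]} else {})"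
proof -
  have "cs = [c]" if "cs \<in> accepting_paths_from M x c" for cs
  proof (cases cs)
    case (Cons d ds)
    then show ?thesis
      using that assms
      by (cases ds) (auto simp: accepting_paths_from_def halted_def)
  qed (use that in \<open>simp add: accepting_paths_from_def\<close>)
  moreover have "[c] \<in> accepting_paths_from M x c \<longleftrightarrow> fst c \<in> accepting M"
    using assms by (simp add: accepting_paths_from_def)
  ultimately show ?thesis by auto
qed

lemma accepting_paths_from_step:
  assumes "\<not> halted M x c"
  shows "accepting_paths_from M x c =
    (\<Union>c' \<in> {c'. ntm_step M x c c'}. (#) c ` accepting_paths_from M x c')"
    (is "?A = ?B")
proof
  show "?A \<subseteq> ?B"
  proof
    fix cs assume cs: "cs \<in> ?A"
    then obtain ds where ds: "cs = c # ds"
      by (cases cs) (auto simp: accepting_paths_from_def)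
    then obtain c' es where es: "ds = c' # es"
      using cs assms by (cases ds) (auto simp: accepting_paths_from_def)
    have "ntm_step M x c c'" "ds \<in> accepting_paths_from M x c'"
      using cs ds es by (auto simp: accepting_paths_from_def)
    then show "cs \<in> ?B" using ds by blast
  qed
  show "?B \<subseteq> ?A"
    by (auto simp: accepting_paths_from_def successively_Cons)
qed

lemma path_count_card:
  assumes "path_count M x b c v"
  shows "finite (accepting_paths_from M x c) \<and> card (accepting_paths_from M x c) = v"
  using assms
proof induction
  case (halt c)
  then show ?case by (simp add: accepting_paths_from_halted)
next
  case (step c g)
  let ?S = "{c'. ntm_step M x c c'}"
  let ?B = "\<lambda>c'. (#) c ` accepting_paths_from M x c'"
  have "card (\<Union>c' \<in> ?S. ?B c') = (\<Sum>c' \<in> ?S. card (?B c'))"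
    using step by (intro card_UN_disjoint) (auto simp: accepting_paths_from_def)
  also have "\<dots> = sum g ?S"
    using step.IH by (intro sum.cong) (auto simp: card_image)
  finally show ?case
    using step by (auto simp: accepting_paths_from_step)
qed

lemma path_count_halts:
  assumes "path_count M x b c v" "cs 0 = c" "\<And>i. ntm_step M x (cs i) (cs (Suc i))"
  shows False
  using assms
proof (induction arbitrary: cs)
  case (halt c)
  then show ?case by (metis halted_def)
next
  case (step c g)
  show ?case
    using step.IH[of "cs 1" "\<lambda>i. cs (Suc i)"] step.prems by (metis One_nat_def)
qed

lemma path_count_heads_below:
  assumes "path_count M x b c v" "(ntm_step M x)\<^sup>*\<^sup>* c d"
  shows "heads_below b d"
  using assms
proof induction
  case (halt c)
  then show ?case by (metis converse_rtranclpE halted_def)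
next
  case (step c g)
  then show ?case by (metis converse_rtranclpE)
qed

lemma path_count_init:
  assumes "path_count M x b (init_config M) v"
  shows "halts_on_all_paths M x" "space_bounded M x b" "card (accepting_paths M x) = v"
proof -
  show "halts_on_all_paths M x"
    unfolding halts_on_all_paths_def using path_count_halts[OF assms] by blast
  show "space_bounded M x b"
    unfolding space_bounded_def using path_count_heads_below[OF assms]
    by (fastforce simp: heads_below_def)
  show "card (accepting_paths M x) = v"
    using path_count_card[OF assms] by (simp add: accepting_paths_from_def accepting_paths_def)
qed

lemma path_count_det_step:
  assumes succ: "{c'. ntm_step M x c c'} = {d}" and "heads_below b c" "path_count M x b d v"
  shows "path_count M x b c v"
proof -
  have "ntm_step M x c c' \<longleftrightarrow> c' = d" for c'
    using succ by blast
  then have "path_count M x b c (\<Sum>c' | ntm_step M x c c'. v)"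
    using assms by (intro path_count.step) (simp_all add: halted_def)
  then show ?thesis using succ by simp
qed


section \<open>Compiling counter programs to Turing machines\<close>

text \<open>
  Instructions of a program with labels \<open>'l\<close> that works on finitely many counters and on the
  read-only input. \<open>Setup q\<close> initialises the counters, moves the input head to cell 1 and goes
  to \<open>q\<close>; it is only meant for the first step. \<open>Incr j q\<close> increments counter \<open>j\<close>. \<open>Decr j q q'\<close>
  decrements counter \<open>j\<close> and goes to \<open>q\<close> if it is positive, and otherwise goes to \<open>q'\<close>. \<open>Branch f\<close>
  chooses a pair from \<open>f s\<close>, where \<open>s\<close> is the scanned input symbol, and moves the input head and
  jumps accordingly; it halts if there is none.
\<close>

datatype 'l instr =
    Setup 'l
  | Incr nat 'l
  | Decr nat 'l 'l
  | Branch "input_symbol \<Rightarrow> (direction \<times> 'l) set"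

text \<open>
  Each label yields three states of the Turing machine. In the phase \<open>Forward\<close> an instruction starts
  and propagates carries or borrows to the right; in the other two phases the work head returns to
  the left end. In \<open>BackZero\<close>, a decrement has turned out to be impossible, and the digits that were
  changed on the way to the right are restored.
\<close>

datatype phase = Forward | Back | BackZero

instance phase :: finite
proof
  have "UNIV = {Forward, Back, BackZero}"
    using phase.exhaust by blast
  then show "finite (UNIV :: phase set)"
    by (metis finite.emptyI finite.insertI)
qed

text \<open>
  Each counter has its own work tape. Cell 0 contains a marker, which allows the head to find the
  left end. Digits are distinguished from blanks, so that a decrement of 0 can be detected.
\<close>

abbreviation (input) "blank_sym \<equiv> 0 :: nat"
abbreviation (input) "zero_sym \<equiv> 1 :: nat"
abbreviation (input) "one_sym \<equiv> 2 :: nat"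
abbreviation (input) "mark_sym \<equiv> 3 :: nat"

definition keep :: "nat list \<Rightarrow> (nat \<times> direction) list" where
  "keep ss = map (\<lambda>s. (s, Stay)) ss"

definition put :: "nat list \<Rightarrow> nat \<Rightarrow> nat \<Rightarrow> direction \<Rightarrow> (nat \<times> direction) list" where
  "put ss j s d = (keep ss)[j := (s, d)]"

text \<open>
  The transitions of the compiled machine from state \<open>(l, ph)\<close> when it reads \<open>a\<close> on the input and
  \<open>ss\<close> on the work tapes.
\<close>

fun delta :: "('l \<Rightarrow> 'l instr) \<Rightarrow> 'l \<times> phase \<Rightarrow> input_symbol \<Rightarrow> nat list \<Rightarrow>
    (('l \<times> phase) \<times> direction \<times> (nat \<times> direction) list) set" where
  "delta P (l, ph) a ss = (case P l of
     Setup q \<Rightarrow> {((q, Forward), MoveRight, map (\<lambda>_. (mark_sym, MoveRight)) ss)}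
   | Incr j q \<Rightarrow> (case ph of
       Forward \<Rightarrow>
         if ss ! j = one_sym then {((l, Forward), Stay, put ss j zero_sym MoveRight)}
         else {((l, Back), Stay, put ss j one_sym MoveLeft)}
     | _ \<Rightarrow>
         if ss ! j = mark_sym then {((q, Forward), Stay, put ss j mark_sym MoveRight)}
         else {((l, Back), Stay, put ss j (ss ! j) MoveLeft)})
   | Decr j q q' \<Rightarrow> (case ph of
       Forward \<Rightarrow>
         if ss ! j = zero_sym then {((l, Forward), Stay, put ss j one_sym MoveRight)}
         else if ss ! j = one_sym then {((l, Back), Stay, put ss j zero_sym MoveLeft)}
         else {((l, BackZero), Stay, put ss j (ss ! j) MoveLeft)}
     | Back \<Rightarrow>
         if ss ! j = mark_sym then {((q, Forward), Stay, put ss j mark_sym MoveRight)}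
         else {((l, Back), Stay, put ss j (ss ! j) MoveLeft)}
     | BackZero \<Rightarrow>
         if ss ! j = mark_sym then {((q', Forward), Stay, put ss j mark_sym MoveRight)}
         else {((l, BackZero), Stay, put ss j zero_sym MoveLeft)})
   | Branch f \<Rightarrow> (\<lambda>(d, q). ((q, Forward), d, keep ss)) ` f a)"

declare delta.simps [simp del]

text \<open>
  The Turing machine for the program \<open>P\<close> with \<open>k\<close> counters, start label \<open>l\<^sub>0\<close> and accepting labels
  \<open>A\<close>. States are encoded as natural numbers by \<open>to_nat\<close>.
\<close>

definition compile :: "nat \<Rightarrow> ('l::finite \<Rightarrow> 'l instr) \<Rightarrow> 'l \<Rightarrow> 'l set \<Rightarrow> (nat, nat) ntm"
  where
  "compile k P l\<^sub>0 A =
     \<lparr>num_tapes = k,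
      states = range (to_nat :: 'l \<times> phase \<Rightarrow> nat),
      alphabet = {..3},
      blank = blank_sym,
      start = to_nat (l\<^sub>0, Forward),
      accepting = to_nat ` (\<lambda>l. (l, Forward)) ` A,
      transitions = {(to_nat p, a, ss, to_nat p', d, acts) | p a ss p' d acts.
        length ss = k \<and> set ss \<subseteq> {..3} \<and> (p', d, acts) \<in> delta P p a ss}\<rparr>"

lemma delta_acts:
  assumes "(p', d, acts) \<in> delta P p a ss" "set ss \<subseteq> {..3}"
  shows "length acts = length ss" "fst ` set acts \<subseteq> {..3}"
proof -
  have keep: "length (keep ss) = length ss \<and> fst ` set (keep ss) \<subseteq> {..3}"
    using assms(2) by (auto simp: keep_def)
  have upd: "length (put ss j s e) = length ss \<and> fst ` set (put ss j s e) \<subseteq> {..3}"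
    if "s \<le> 3" for j s e
    using keep that set_update_subset_insert[of "keep ss" j "(s, e)"]
    by (fastforce simp: put_def)
  have upd_same: "length (put ss j (ss ! j) e) = length ss \<and>
      fst ` set (put ss j (ss ! j) e) \<subseteq> {..3}" for j e
  proof (cases "j < length ss")
    case True
    then have "ss ! j \<le> 3" using assms(2) by (auto simp: subset_iff)
    then show ?thesis by (rule upd)
  next
    case False
    then show ?thesis using keep by (simp add: put_def list_update_beyond keep_def)
  qed
  obtain l ph where "p = (l, ph)" by (cases p)
  then have "length acts = length ss \<and> fst ` set acts \<subseteq> {..3}"
    using assms(1) keep upd upd_same
    by (auto simp: delta.simps split: instr.splits phase.splits if_splits)
  then show "length acts = length ss" "fst ` set acts \<subseteq> {..3}" by auto
qed

lemma wf_compile: "wf_ntm (compile k P l\<^sub>0 A)"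
proof -
  let ?M = "compile k P l\<^sub>0 A"
  have "case t of (p, a, ss, p', d, acts) \<Rightarrow>
      p \<in> states ?M \<and> p' \<in> states ?M \<and>
      length ss = num_tapes ?M \<and> set ss \<subseteq> alphabet ?M \<and>
      length acts = num_tapes ?M \<and> fst ` set acts \<subseteq> alphabet ?M"
    if "t \<in> transitions ?M" for t
  proof -
    obtain p a ss p' d acts where "t = (to_nat p, a, ss, to_nat p', d, acts)"
      "length ss = k" "set ss \<subseteq> {..3}" "(p', d, acts) \<in> delta P p a ss"
      using \<open>t \<in> transitions ?M\<close> unfolding compile_def by auto
    then show ?thesis
      using delta_acts[of p' d acts P p a ss] by (simp add: compile_def)
  qed
  then show ?thesis
    unfolding wf_ntm_def by (auto simp: compile_def)
qed

lemma ntm_step_compile: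
  assumes "length ts = k" "set (map tape_read ts) \<subseteq> {..3}"
  shows "{c'. ntm_step (compile k P l\<^sub>0 A) x (to_nat (p :: 'l::finite \<times> phase), i, ts) c'} =
    (\<lambda>(p', d, acts). (to_nat p', min (move d i) (length x + 1), map2 tape_act ts acts)) `
      delta P p (input_symbol x i) (map tape_read ts)"
proof -
  let ?M = "compile k P l\<^sub>0 A"
  have trans: "(to_nat p, a, ss, q', d, acts) \<in> transitions ?M \<longleftrightarrow>
      length ss = k \<and> set ss \<subseteq> {..3} \<and> (\<exists>p'. q' = to_nat p' \<and> (p', d, acts) \<in> delta P p a ss)"
    for a ss q' d acts
    unfolding compile_def by (auto simp del: split_paired_Ex)
  have step: "ntm_step ?M x (to_nat p, i, ts) c' \<longleftrightarrow>
      (\<exists>q' d acts. (to_nat p, input_symbol x i, map tape_read ts, q', d, acts) \<in> transitions ?M \<and>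
        c' = (q', min (move d i) (length x + 1), map2 tape_act ts acts))" for c'
    by (subst ntm_step.simps) blast
  have succ: "ntm_step ?M x (to_nat p, i, ts) c' \<longleftrightarrow>
      (\<exists>p' d acts. (p', d, acts) \<in> delta P p (input_symbol x i) (map tape_read ts) \<and>
        c' = (to_nat p', min (move d i) (length x + 1), map2 tape_act ts acts))" for c'
    unfolding step trans using assms by (simp del: split_paired_Ex) blast
  have image: "{c. \<exists>p d acts. (p, d, acts) \<in> D \<and> c = F p d acts} = (\<lambda>(p, d, acts). F p d acts) ` D"
    for D :: "(('l \<times> phase) \<times> direction \<times> (nat \<times> direction) list) set"
      and F :: "'l \<times> phase \<Rightarrow> direction \<Rightarrow> (nat \<times> direction) list \<Rightarrow> (nat, nat) config"
    by force
  show ?thesis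
    unfolding succ by (rule image)
qed

lemma tape_act_keep: "tape_act t (tape_read t, Stay) = t"
  by (cases t) simp

lemma map2_tape_act_keep: "map2 tape_act ts (keep (map tape_read ts)) = ts"
  by (rule nth_equalityI) (auto simp: keep_def tape_act_keep)

lemma map2_tape_act_put:
  assumes "j < length ts"
  shows "map2 tape_act ts (put (map tape_read ts) j s d) = ts[j := tape_act (ts ! j) (s, d)]"
proof -
  have "map2 tape_act ts ((keep (map tape_read ts))[j := (s, d)]) =
      (map2 tape_act ts (keep (map tape_read ts)))[j := tape_act (ts ! j) (s, d)]"
    using assms by (intro nth_equalityI) (auto simp: keep_def nth_list_update)
  then show ?thesis by (simp add: put_def map2_tape_act_keep)
qed


subsection \<open>Binary counters\<close>

text \<open>
  Binary numbers are lists of digits with the least significant digit first. Leading zeros, which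
  are at the end of the list, are allowed; decrementing never shortens a number.
\<close>

fun bin_val :: "bool list \<Rightarrow> nat" where
  "bin_val [] = 0"
| "bin_val (b # bs) = of_bool b + 2 * bin_val bs"

fun bin_inc :: "bool list \<Rightarrow> bool list" where
  "bin_inc [] = [True]"
| "bin_inc (False # bs) = True # bs"
| "bin_inc (True # bs) = False # bin_inc bs"

fun bin_dec :: "bool list \<Rightarrow> bool list" where
  "bin_dec [] = []"
| "bin_dec (True # bs) = False # bs"
| "bin_dec (False # bs) = True # bin_dec bs"

lemma bin_val_inc: "bin_val (bin_inc bs) = Suc (bin_val bs)"
  by (induction bs rule: bin_inc.induct) auto

lemma length_bin_inc: "length (bin_inc bs) = length bs \<or>
    length (bin_inc bs) = Suc (length bs) \<and> Suc (bin_val bs) = 2 ^ length bs"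
  by (induction bs rule: bin_inc.induct) auto

lemma bin_val_dec: "bin_val bs > 0 \<Longrightarrow> bin_val (bin_dec bs) = bin_val bs - 1"
  by (induction bs rule: bin_dec.induct) auto

lemma length_bin_dec [simp]: "length (bin_dec bs) = length bs"
  by (induction bs rule: bin_dec.induct) auto

lemma bin_val_eq_0: "bin_val bs = 0 \<longleftrightarrow> bs = replicate (length bs) False"
  by (induction bs) auto

text \<open>
  The content of a work tape that stores a binary number: the marker in cell 0, followed by the
  digits and blanks.
\<close>

definition cells :: "bool list \<Rightarrow> nat \<Rightarrow> nat" where
  "cells bs i = (if i = 0 then mark_sym else if i \<le> length bs then
     (if bs ! (i - 1) then one_sym else zero_sym) else blank_sym)"

lemma cells_0 [simp]: "cells bs 0 = 3"
  by (simp add: cells_def)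

lemma cells_le_3: "cells bs i \<le> 3"
  by (simp add: cells_def)

lemma cells_eq_3: "cells bs i = 3 \<longleftrightarrow> i = 0"
  by (simp add: cells_def)

lemma cells_end: "cells bs (Suc (length bs)) = 0"
  by (simp add: cells_def)

lemma cells_digit: "cells (bs @ d # bs') (Suc (length bs)) = (if d then 2 else 1)"
  by (simp add: cells_def)

lemma cells_write_digit:
  "(cells (bs @ d # bs'))(Suc (length bs) := if e then 2 else 1) = cells (bs @ e # bs')"
  by (rule ext) (auto simp: cells_def nth_append nth_Cons')

lemma cells_write_end:
  "(cells bs)(Suc (length bs) := if e then 2 else 1) = cells (bs @ [e])"
  by (rule ext) (auto simp: cells_def nth_append nth_Cons')

text \<open>
  The tape represents the counter value \<open>v\<close> with at most \<open>L\<close> digits, and its head is at the least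
  significant digit.
\<close>

definition counter_tape :: "nat \<Rightarrow> nat \<Rightarrow> nat tape \<Rightarrow> bool" where
  "counter_tape L v t \<longleftrightarrow> (\<exists>bs. t = (cells bs, 1) \<and> bin_val bs = v \<and> length bs \<le> L)"



subsection \<open>Simulation\<close>

text \<open>
  A program with \<open>k\<close> counters on the fixed input \<open>x\<close>, whose counters have at most \<open>L\<close> digits.
  Together with the marker and the blank after the last digit this requires \<open>L + 2\<close> cells.
\<close>

locale counter_program =
  fixes k :: nat and P :: "'l::finite \<Rightarrow> 'l instr" and l\<^sub>0 :: 'l and A :: "'l set"
    and x :: "bool list" and L :: nat
begin

abbreviation machine :: "(nat, nat) ntm" where
  "machine \<equiv> compile k P l\<^sub>0 A"

abbreviation config :: "'l \<Rightarrow> phase \<Rightarrow> nat \<Rightarrow> nat tape list \<Rightarrow> (nat, nat) config" where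
  "config l ph i ts \<equiv> (to_nat (l, ph), i, ts)"

abbreviation count :: "(nat, nat) config \<Rightarrow> nat \<Rightarrow> bool" where
  "count \<equiv> path_count machine x (L + 2)"

text \<open>
  The relation \<open>leads c c'\<close> holds in particular if \<open>c'\<close> is reached from \<open>c\<close> deterministically in
  bounded space.
\<close>

definition leads :: "(nat, nat) config \<Rightarrow> (nat, nat) config \<Rightarrow> bool" where
  "leads c c' \<longleftrightarrow> (\<forall>v. count c' v \<longrightarrow> count c v)"

lemma leads_trans [trans]: "leads c c' \<Longrightarrow> leads c' c'' \<Longrightarrow> leads c c''"
  by (simp add: leads_def)

text \<open>
  The work tapes are as in some configuration that obeys the space bound; only the cells
  under the heads matter.
\<close>

definition tidy :: "nat tape list \<Rightarrow> bool" where
  "tidy ts \<longleftrightarrow> length ts = k \<and> (\<forall>t \<in> set ts. tape_read t \<le> 3 \<and> snd t < L + 2)"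

lemma tidy_update: "tidy ts \<Longrightarrow> h < L + 2 \<Longrightarrow> tidy (ts[j := (cells bs, h)])"
  using set_update_subset_insert[of ts j "(cells bs, h)"]
  by (auto simp: tidy_def cells_le_3)

lemma tidy_heads_below: "tidy ts \<Longrightarrow> heads_below (L + 2) (p, i, ts)"
  by (auto simp: tidy_def heads_below_def)

lemma tidy_step:
  assumes "tidy ts"
  shows "{c'. ntm_step machine x (config l ph i ts) c'} =
    (\<lambda>(p', d, acts). (to_nat p', min (move d i) (length x + 1), map2 tape_act ts acts)) `
      delta P (l, ph) (input_symbol x i) (map tape_read ts)"
  using assms by (intro ntm_step_compile) (auto simp: tidy_def)

lemma leads_step:
  assumes "tidy ts" "j < k" "h < L + 2" "i \<le> Suc (length x)"
    and delta: "\<And>ss. ss ! j = cells bs h \<Longrightarrow>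
      delta P (l, ph) (input_symbol x i) ss = {((l', ph'), Stay, put ss j s d)}"
    and "(cells bs)(h := s) = cells bs'" "move d h = h'"
  shows "leads (config l ph i (ts[j := (cells bs, h)])) (config l' ph' i (ts[j := (cells bs', h')]))"
proof -
  let ?ts = "ts[j := (cells bs, h)]"
  have tidy: "tidy ?ts" using assms by (intro tidy_update)
  have j: "j < length ts" using assms by (simp add: tidy_def)
  have "map2 tape_act ?ts (put (map tape_read ?ts) j s d) = ts[j := (cells bs', h')]"
    using map2_tape_act_put[of j ?ts s d] assms(6,7) j by simp
  then have succ: "{c'. ntm_step machine x (config l ph i ?ts) c'} =
      {config l' ph' i (ts[j := (cells bs', h')])}"
    unfolding tidy_step[OF tidy] using delta[of "map tape_read ?ts"] j assms(4) by simp
  show ?thesis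
    unfolding leads_def
    by (intro allI impI path_count_det_step[OF succ tidy_heads_below[OF tidy]])
qed

text \<open>
  In a returning phase that does not change the tape, the head of tape \<open>j\<close> moves back to cell 1.
  The hypothesis on \<open>delta\<close> covers increments as well as successful decrements.
\<close>

lemma leads_back:
  assumes ts: "tidy ts" "j < k" "i \<le> Suc (length x)"
    and delta: "\<And>a ss. delta P (l, ph) a ss =
      (if ss ! j = 3 then {((q, Forward), Stay, put ss j 3 MoveRight)}
       else {((l, ph), Stay, put ss j (ss ! j) MoveLeft)})"
    and bs: "length bs \<le> L" "h \<le> length bs"
  shows "leads (config l ph i (ts[j := (cells bs, h)]))
    (config q Forward i (ts[j := (cells bs, 1)]))"
  using bs(2)
proof (induction h)
  case 0
  have "(cells bs)(0 := 3) = cells bs" by (metis cells_0 fun_upd_triv)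
  then show ?case
    using ts by (intro leads_step) (auto simp: delta tidy_def)
next
  case (Suc h)
  have "leads (config l ph i (ts[j := (cells bs, Suc h)])) (config l ph i (ts[j := (cells bs, h)]))"
    using ts Suc.prems bs(1)
    by (intro leads_step[where s = "cells bs (Suc h)"])
      (auto simp: delta tidy_def cells_eq_3)
  also have "leads \<dots> (config q Forward i (ts[j := (cells bs, 1)]))"
    using Suc by simp
  finally show ?case .
qed

text \<open>
  A failed decrement has turned zeros into ones, which are turned back on the way to the left.
\<close>

lemma leads_back_zero:
  assumes ts: "tidy ts" "j < k" "i \<le> Suc (length x)"
    and P: "P l = Decr j q q'"
    and "m + n \<le> L"
  shows "leads (config l BackZero i (ts[j := (cells (replicate m True @ replicate n False), m)]))
    (config q' Forward i (ts[j := (cells (replicate (m + n) False), 1)]))"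
  using assms(5)
proof (induction m arbitrary: n)
  case 0
  have "(cells (replicate n False))(0 := 3) = cells (replicate n False)"
    by (metis cells_0 fun_upd_triv)
  then show ?case
    using ts P 0 by (simp, intro leads_step) (auto simp: delta.simps tidy_def)
next
  case (Suc m)
  let ?bs = "replicate (Suc m) True @ replicate n False"
  let ?bs' = "replicate m True @ replicate (Suc n) False"
  have bs: "?bs = replicate m True @ True # replicate n False"
    "?bs' = replicate m True @ False # replicate n False"
    by (simp_all add: replicate_app_Cons_same)
  have upd: "(cells ?bs)(Suc m := 1) = cells ?bs'"
    using cells_write_digit[of "replicate m True" True "replicate n False" False]
    unfolding bs by simp
  have "leads (config l BackZero i (ts[j := (cells ?bs, Suc m)]))
      (config l BackZero i (ts[j := (cells ?bs', m)]))"
    by (rule leads_step[where s = 1 and d = MoveLeft])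
      (use ts P Suc.prems upd in \<open>auto simp: delta.simps tidy_def cells_eq_3\<close>)
  also have "leads \<dots> (config q' Forward i (ts[j := (cells (replicate (Suc m + n) False), 1)]))"
    using Suc.IH[of "Suc n"] Suc.prems by simp
  finally show ?case .
qed

text \<open>
  The first \<open>n\<close> digits have already been set to 0 by the carry.
\<close>

lemma leads_incr:
  assumes ts: "tidy ts" "j < k" "i \<le> Suc (length x)"
    and P: "P l = Incr j q"
    and bs: "length (replicate n False @ bin_inc bs) \<le> L"
  shows "leads (config l Forward i (ts[j := (cells (replicate n False @ bs), Suc n)]))
    (config q Forward i (ts[j := (cells (replicate n False @ bin_inc bs), 1)]))"
  using bs
proof (induction bs arbitrary: n rule: bin_inc.induct)
  case 1
  have "leads (config l Forward i (ts[j := (cells (replicate n False), Suc n)]))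
      (config l Back i (ts[j := (cells (replicate n False @ [True]), n)]))"
    using ts P 1 cells_write_end[of "replicate n False" True] cells_end[of "replicate n False"]
    by (intro leads_step[where s = 2]) (auto simp: delta.simps tidy_def)
  also have "leads \<dots> (config q Forward i (ts[j := (cells (replicate n False @ [True]), 1)]))"
    using ts P 1 by (intro leads_back) (auto simp: delta.simps)
  finally show ?case by simp
next
  case (2 bs)
  have "leads (config l Forward i (ts[j := (cells (replicate n False @ False # bs), Suc n)]))
      (config l Back i (ts[j := (cells (replicate n False @ True # bs), n)]))"
    using ts P 2 cells_write_digit[of "replicate n False" False bs True]
      cells_digit[of "replicate n False" False bs]
    by (intro leads_step[where s = 2]) (auto simp: delta.simps tidy_def)
  also have "leads \<dots> (config q Forward i (ts[j := (cells (replicate n False @ True # bs), 1)]))"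
    using ts P 2 by (intro leads_back) (auto simp: delta.simps)
  finally show ?case by simp
next
  case (3 bs)
  have shift: "replicate n False @ False # cs = replicate (Suc n) False @ cs" for cs
    by (simp add: replicate_app_Cons_same)
  have "length bs \<le> length (bin_inc bs)"
    using length_bin_inc[of bs] by auto
  then have "leads (config l Forward i (ts[j := (cells (replicate n False @ True # bs), Suc n)]))
      (config l Forward i (ts[j := (cells (replicate n False @ False # bs), Suc (Suc n))]))"
    using ts P 3(2) cells_write_digit[of "replicate n False" True bs False]
      cells_digit[of "replicate n False" True bs]
    by (intro leads_step[where s = 1]) (auto simp: delta.simps tidy_def)
  also have "leads \<dots>
      (config q Forward i (ts[j := (cells (replicate n False @ False # bin_inc bs), 1)]))"
    unfolding shift using "3.IH"[of "Suc n"] "3.prems" by simp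
  finally show ?case by simp
qed

text \<open>
  The first \<open>n\<close> digits have already been set to 1 by the borrow.
\<close>

lemma leads_decr_pos:
  assumes ts: "tidy ts" "j < k" "i \<le> Suc (length x)"
    and P: "P l = Decr j q q'"
    and bs: "length (replicate n True @ bs) \<le> L" "bin_val bs > 0"
  shows "leads (config l Forward i (ts[j := (cells (replicate n True @ bs), Suc n)]))
    (config q Forward i (ts[j := (cells (replicate n True @ bin_dec bs), 1)]))"
  using bs
proof (induction bs arbitrary: n rule: bin_dec.induct)
  case 1
  then show ?case by simp
next
  case (2 bs)
  have "leads (config l Forward i (ts[j := (cells (replicate n True @ True # bs), Suc n)]))
      (config l Back i (ts[j := (cells (replicate n True @ False # bs), n)]))"
    using ts P 2 cells_write_digit[of "replicate n True" True bs False]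
      cells_digit[of "replicate n True" True bs]
    by (intro leads_step[where s = 1]) (auto simp: delta.simps tidy_def)
  also have "leads \<dots> (config q Forward i (ts[j := (cells (replicate n True @ False # bs), 1)]))"
    using ts P 2 by (intro leads_back) (auto simp: delta.simps)
  finally show ?case by simp
next
  case (3 bs)
  have shift: "replicate n True @ True # cs = replicate (Suc n) True @ cs" for cs
    by (simp add: replicate_app_Cons_same)
  have "leads (config l Forward i (ts[j := (cells (replicate n True @ False # bs), Suc n)]))
      (config l Forward i (ts[j := (cells (replicate n True @ True # bs), Suc (Suc n))]))"
    using ts P 3(2) cells_write_digit[of "replicate n True" False bs True]
      cells_digit[of "replicate n True" False bs]
    by (intro leads_step[where s = 2]) (auto simp: delta.simps tidy_def)
  also have "leads \<dots>
      (config q Forward i (ts[j := (cells (replicate n True @ True # bin_dec bs), 1)]))"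
    unfolding shift using "3.IH"[of "Suc n"] "3.prems" by simp
  finally show ?case by simp
qed

lemma leads_decr_zero:
  assumes ts: "tidy ts" "j < k" "i \<le> Suc (length x)"
    and P: "P l = Decr j q q'"
    and "m + n \<le> L"
  shows "leads (config l Forward i (ts[j := (cells (replicate m True @ replicate n False), Suc m)]))
    (config q' Forward i (ts[j := (cells (replicate (m + n) False), 1)]))"
  using assms(5)
proof (induction n arbitrary: m)
  case 0
  have "leads (config l Forward i (ts[j := (cells (replicate m True), Suc m)]))
      (config l BackZero i (ts[j := (cells (replicate m True), m)]))"
    using ts P 0 cells_end[of "replicate m True"]
    by (intro leads_step[where s = 0]) (auto simp: delta.simps tidy_def)
  also have "leads \<dots> (config q' Forward i (ts[j := (cells (replicate m False), 1)]))"
    using leads_back_zero[OF ts P, of m 0] 0 by simp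
  finally show ?case by simp
next
  case (Suc n)
  let ?bs = "replicate m True @ False # replicate n False"
  have bs: "replicate m True @ True # replicate n False = replicate (Suc m) True @ replicate n False"
    by (simp add: replicate_app_Cons_same)
  have "leads (config l Forward i (ts[j := (cells ?bs, Suc m)]))
      (config l Forward i (ts[j := (cells (replicate m True @ True # replicate n False), Suc (Suc m))]))"
    using ts P Suc.prems cells_write_digit[of "replicate m True" False "replicate n False" True]
      cells_digit[of "replicate m True" False "replicate n False"]
    by (intro leads_step[where s = 2]) (auto simp: delta.simps tidy_def)
  also have "leads \<dots> (config q' Forward i (ts[j := (cells (replicate (m + Suc n) False), 1)]))"
    unfolding bs using Suc.IH[of "Suc m"] Suc.prems by simp
  finally show ?case by simp
qed

text \<open>
  From label \<open>l\<close>, input head position \<open>i\<close> and counter values \<open>vs\<close>, the compiled machine has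
  exactly \<open>v\<close> accepting paths, whichever admissible binary representations of the counter values
  are on the tapes.
\<close>

definition computes :: "'l \<Rightarrow> nat \<Rightarrow> nat list \<Rightarrow> nat \<Rightarrow> bool" where
  "computes l i vs v \<longleftrightarrow> length vs = k \<and>
     (\<forall>ts. list_all2 (counter_tape L) vs ts \<longrightarrow> count (config l Forward i ts) v)"

lemma tidy_counter_tapes:
  assumes "list_all2 (counter_tape L) vs ts" "length vs = k"
  shows "tidy ts"
  unfolding tidy_def
proof (intro conjI ballI)
  show "length ts = k" using assms list_all2_lengthD by fastforce
  fix t assume "t \<in> set ts"
  then obtain v where "counter_tape L v t"
    using assms(1) by (metis in_set_conv_nth list_all2_conv_all_nth)
  then show "tape_read t \<le> 3" "snd t < L + 2"
    by (auto simp: counter_tape_def cells_le_3)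
qed

lemma counter_tapes_nth:
  assumes "list_all2 (counter_tape L) vs ts" "j < length vs"
  obtains bs where "ts ! j = (cells bs, 1)" "bin_val bs = vs ! j" "length bs \<le> L"
    "ts[j := (cells bs, 1)] = ts"
proof -
  have "counter_tape L (vs ! j) (ts ! j)"
    using assms by (simp add: list_all2_conv_all_nth)
  then show ?thesis
    using that unfolding counter_tape_def by (metis list_update_id)
qed

lemma computes_Incr:
  assumes P: "P l = Incr j q" and j: "j < k" and i: "i \<le> Suc (length x)"
    and bound: "Suc (vs ! j) < 2 ^ L" and q: "computes q i (vs[j := Suc (vs ! j)]) v"
  shows "computes l i vs v"
  unfolding computes_def
proof (intro conjI allI impI)
  show k: "length vs = k" using q by (simp add: computes_def)
  fix ts assume ts: "list_all2 (counter_tape L) vs ts"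
  obtain bs where bs: "bin_val bs = vs ! j" "length bs \<le> L" "ts[j := (cells bs, 1)] = ts"
    using counter_tapes_nth[OF ts] j k by metis
  have len: "length (bin_inc bs) \<le> L"
  proof (cases "length (bin_inc bs) = length bs")
    case False
    \<comment> \<open>a new digit is only needed if all digits are 1\<close>
    then have "(2::nat) ^ length bs < 2 ^ L" "length (bin_inc bs) = Suc (length bs)"
      using length_bin_inc[of bs] bound bs(1) by auto
    then show ?thesis by simp
  qed (use bs in simp)
  have "counter_tape L (Suc (vs ! j)) (cells (bin_inc bs), 1)"
    using len bs(1) by (auto simp: counter_tape_def bin_val_inc)
  then have "list_all2 (counter_tape L) (vs[j := Suc (vs ! j)]) (ts[j := (cells (bin_inc bs), 1)])"
    using ts by (intro list_all2_update_cong)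
  then have "count (config q Forward i (ts[j := (cells (bin_inc bs), 1)])) v"
    using q by (simp add: computes_def)
  moreover have "leads (config l Forward i ts) (config q Forward i (ts[j := (cells (bin_inc bs), 1)]))"
    using leads_incr[OF tidy_counter_tapes[OF ts k] j i P, of 0 bs] len bs(3) by simp
  ultimately show "count (config l Forward i ts) v"
    by (simp add: leads_def)
qed

lemma computes_Decr_Suc:
  assumes P: "P l = Decr j q q'" and j: "j < k" and i: "i \<le> Suc (length x)"
    and pos: "vs ! j = Suc n" and q: "computes q i (vs[j := n]) v"
  shows "computes l i vs v"
  unfolding computes_def
proof (intro conjI allI impI)
  show k: "length vs = k" using q by (simp add: computes_def)
  fix ts assume ts: "list_all2 (counter_tape L) vs ts"
  obtain bs where bs: "bin_val bs = vs ! j" "length bs \<le> L" "ts[j := (cells bs, 1)] = ts"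
    using counter_tapes_nth[OF ts] j k by metis
  have "counter_tape L n (cells (bin_dec bs), 1)"
    using bs pos by (auto simp: counter_tape_def bin_val_dec)
  then have "list_all2 (counter_tape L) (vs[j := n]) (ts[j := (cells (bin_dec bs), 1)])"
    using ts by (intro list_all2_update_cong)
  then have "count (config q Forward i (ts[j := (cells (bin_dec bs), 1)])) v"
    using q by (simp add: computes_def)
  moreover have "leads (config l Forward i ts) (config q Forward i (ts[j := (cells (bin_dec bs), 1)]))"
    using leads_decr_pos[OF tidy_counter_tapes[OF ts k] j i P, of 0 bs] bs pos by simp
  ultimately show "count (config l Forward i ts) v"
    by (simp add: leads_def)
qed

lemma computes_Decr_0:
  assumes P: "P l = Decr j q q'" and j: "j < k" and i: "i \<le> Suc (length x)"
    and zero: "vs ! j = 0" and q: "computes q' i vs v"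
  shows "computes l i vs v"
  unfolding computes_def
proof (intro conjI allI impI)
  show k: "length vs = k" using q by (simp add: computes_def)
  fix ts assume ts: "list_all2 (counter_tape L) vs ts"
  obtain bs where bs: "bin_val bs = vs ! j" "length bs \<le> L" "ts[j := (cells bs, 1)] = ts"
    using counter_tapes_nth[OF ts] j k by metis
  have "bs = replicate (length bs) False"
    using bs(1) zero by (simp add: bin_val_eq_0 [symmetric])
  then have "leads (config l Forward i ts) (config q' Forward i ts)"
    using leads_decr_zero[OF tidy_counter_tapes[OF ts k] j i P, of 0 "length bs"] bs by simp
  then show "count (config l Forward i ts) v"
    using q ts by (simp add: leads_def computes_def)
qed

lemma step_Branch:
  assumes "P l = Branch f" "list_all2 (counter_tape L) vs ts" "length vs = k"
  shows "{c'. ntm_step machine x (config l Forward i ts) c'} =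
    (\<lambda>(d, q). config q Forward (min (move d i) (length x + 1)) ts) ` f (input_symbol x i)"
  unfolding tidy_step[OF tidy_counter_tapes[OF assms(2,3)]]
  by (simp add: delta.simps assms(1) image_image case_prod_beta map2_tape_act_keep)

lemma computes_halt:
  assumes P: "P l = Branch f" and k: "length vs = k" and f: "f (input_symbol x i) = {}"
  shows "computes l i vs (if l \<in> A then 1 else 0)"
  unfolding computes_def
proof (intro conjI allI impI k)
  fix ts assume ts: "list_all2 (counter_tape L) vs ts"
  have "halted machine x (config l Forward i ts)"
    using step_Branch[OF P ts k, of i] f by (auto simp: halted_def)
  from path_count.halt[OF this tidy_heads_below[OF tidy_counter_tapes[OF ts k]]]
  show "count (config l Forward i ts) (if l \<in> A then 1 else 0)"
    by (simp add: compile_def image_iff)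
qed

lemma computes_Branch:
  assumes branch: "\<exists>f. P l = Branch f \<and> f (input_symbol x i) = {(d, q)}"
    and q: "computes q (min (move d i) (length x + 1)) vs v"
  shows "computes l i vs v"
  unfolding computes_def
proof (intro conjI allI impI)
  obtain f where P: "P l = Branch f" and f: "f (input_symbol x i) = {(d, q)}"
    using branch by blast
  show k: "length vs = k" using q by (simp add: computes_def)
  fix ts assume ts: "list_all2 (counter_tape L) vs ts"
  have "count (config q Forward (min (move d i) (length x + 1)) ts) v"
    using q ts by (simp add: computes_def)
  moreover have "{c'. ntm_step machine x (config l Forward i ts) c'} =
      {config q Forward (min (move d i) (length x + 1)) ts}"
    unfolding step_Branch[OF P ts k] f by simp
  ultimately show "count (config l Forward i ts) v"
    using path_count_det_step tidy_heads_below[OF tidy_counter_tapes[OF ts k]] by metis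
qed

lemma computes_Branch2:
  assumes branch: "\<exists>f. P l = Branch f \<and> f (input_symbol x i) = {(d, q), (d', q')}"
    and neq: "q \<noteq> q'"
    and q: "computes q (min (move d i) (length x + 1)) vs v"
    and q': "computes q' (min (move d' i) (length x + 1)) vs v'"
  shows "computes l i vs (v + v')"
  unfolding computes_def
proof (intro conjI allI impI)
  obtain f where P: "P l = Branch f" and f: "f (input_symbol x i) = {(d, q), (d', q')}"
    using branch by blast
  show k: "length vs = k" using q by (simp add: computes_def)
  fix ts assume ts: "list_all2 (counter_tape L) vs ts"
  let ?c = "config q Forward (min (move d i) (length x + 1)) ts"
  let ?c' = "config q' Forward (min (move d' i) (length x + 1)) ts"
  have succ: "{c'. ntm_step machine x (config l Forward i ts) c'} = {?c, ?c'}"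
    unfolding step_Branch[OF P ts k] f by simp
  have c: "ntm_step machine x (config l Forward i ts) e \<longleftrightarrow> e = ?c \<or> e = ?c'" for e
    using succ by blast
  have "?c \<noteq> ?c'" using neq by simp
  moreover have "count ?c v" "count ?c' v'"
    using q q' ts by (simp_all add: computes_def)
  ultimately have "count (config l Forward i ts)
      (\<Sum>e | ntm_step machine x (config l Forward i ts) e. if e = ?c then v else v')"
    using tidy_heads_below[OF tidy_counter_tapes[OF ts k]]
    by (intro path_count.step) (auto simp: c halted_def)
  then show "count (config l Forward i ts) (v + v')"
    unfolding succ using neq by (simp add: eq_commute[of q' q])
qed

lemma count_init:
  assumes P: "P l\<^sub>0 = Setup q" and q: "computes q 1 (replicate k 0) v"
  shows "count (init_config machine) v"
proof -
  let ?ts = "replicate k (\<lambda>_. blank_sym, 0) :: nat tape list"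
  let ?ts' = "replicate k (cells [], 1) :: nat tape list"
  have init: "init_config machine = config l\<^sub>0 Forward 0 ?ts"
    by (simp add: init_config_def compile_def)
  have tidy: "tidy ?ts"
    by (auto simp: tidy_def)
  have "(\<lambda>_. blank_sym)(0 := mark_sym) = cells []"
    by (auto simp: cells_def)
  then have "map2 tape_act ?ts (map (\<lambda>_. (mark_sym, MoveRight)) (map tape_read ?ts)) = ?ts'"
    by (intro nth_equalityI) auto
  then have succ: "{c'. ntm_step machine x (init_config machine) c'} = {config q Forward 1 ?ts'}"
    unfolding init tidy_step[OF tidy] by (simp add: delta.simps P)
  have heads: "heads_below (L + 2) (init_config machine)"
    unfolding init by (rule tidy_heads_below[OF tidy])
  have "list_all2 (counter_tape L) (replicate k 0) ?ts'"
    by (auto simp: list_all2_conv_all_nth counter_tape_def intro!: exI[of _ "[]"])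
  then have "count (config q Forward 1 ?ts') v"
    using q by (simp add: computes_def)
  then show ?thesis
    by (rule path_count_det_step[OF succ heads])
qed

end

section \<open>Counting inversions with \<open>q\<close>-binomial coefficients\<close>

abbreviation blocks :: "nat list \<Rightarrow> bool list" where
  "blocks as \<equiv> concat (map (\<lambda>a. False # ones a) as)"

text \<open>
  The number of accepting choices of the machine when the word \<open>w\<close> is to the right of its head,
  \<open>m\<close> letters of the current binary word are still to be guessed, \<open>z\<close> zeros have been guessed,
  and \<open>r\<close> is the remaining exponent. The letter 0 separates blocks. At the end of the input the
  total number \<open>m + z\<close> of zeros in the last binary word has to be 0, which enforces that the sum
  of all block lengths is the number \<open>n\<close> at the beginning.
\<close>

fun count_blocks :: "bool list \<Rightarrow> nat \<Rightarrow> nat \<Rightarrow> nat \<Rightarrow> nat" where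
  "count_blocks [] m z r = (if m = 0 \<and> z = 0 \<and> r = 0 then 1 else 0)"
| "count_blocks (False # w) m z r = count_blocks w (m + z) 0 r"
| "count_blocks (True # w) 0 z r = 0"
| "count_blocks (True # w) (Suc m) z r =
     (if z \<le> r then count_blocks w m z (r - z) else 0) + count_blocks (True # w) m (Suc z) r"

text \<open>
  The number of accepting choices while the machine is still reading \<open>r\<close>, respectively \<open>n\<close>.
  Words with fewer than two zeros are rejected.
\<close>

fun count_r :: "bool list \<Rightarrow> nat \<Rightarrow> nat \<Rightarrow> nat" where
  "count_r [] n r = 0"
| "count_r (True # w) n r = count_r w n (Suc r)"
| "count_r (False # w) n r = count_blocks w n 0 r"

fun count_n :: "bool list \<Rightarrow> nat \<Rightarrow> nat" where
  "count_n [] n = 0"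
| "count_n (True # w) n = count_n w (Suc n)"
| "count_n (False # w) n = count_r w n 0"

text \<open>
  The \<open>q\<close>-multinomial coefficient as a polynomial, and 0 if the sum of the list is not \<open>n\<close>.
\<close>

fun multinomial_poly :: "nat list \<Rightarrow> nat \<Rightarrow> int poly" where
  "multinomial_poly [] n = (if n = 0 then 1 else 0)"
| "multinomial_poly (a # as) n = q_binomial_poly n a * multinomial_poly as (n - a)"

lemma to_fract_multinomial_poly:
  "sum_list as = n \<Longrightarrow> to_fract (multinomial_poly as n) = q_multinomial n as"
proof (induction as arbitrary: n)
  case (Cons a as)
  then have "a \<le> n" "to_fract (multinomial_poly as (n - a)) = q_multinomial (n - a) as"
    by auto
  then show ?case by (simp add: to_fract_q_binomial_poly)
qed simp

lemma multinomial_poly_eq_0: "sum_list as \<noteq> n \<Longrightarrow> multinomial_poly as n = 0"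
proof (induction as arbitrary: n)
  case (Cons a as)
  then show ?case by (cases "a \<le> n") (auto simp: q_binomial_poly_eq_0)
qed simp

text \<open>
  The recursion of \<open>count_blocks\<close> along a block is the recursion for \<open>q\<close>-binomial coefficients up
  to the factor \<open>q ^ (a * z)\<close>. The polynomial \<open>F N\<close> stands for the contribution of the blocks that
  follow, when \<open>N\<close> is the length of the next binary word.
\<close>

lemma count_blocks_ones:
  assumes "\<And>m z r. int (count_blocks w m z r) = coeff (F (m + z)) r"
  shows "int (count_blocks (ones a @ w) m z r) =
    coeff (monom 1 (a * z) * (q_binomial_poly m a * F (m + z - a))) r"
proof (induction a arbitrary: m z r)
  case 0
  then show ?case using assms by (simp add: ones_def)
next
  case (Suc a)
  show ?case
  proof (induction m arbitrary: z r)
    case 0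
    then show ?case by (simp add: ones_def)
  next
    case (Suc m)
    let ?F = "F (m + z - a)"
    have ones: "ones (Suc a) @ w = True # ones a @ w"
      by (simp add: ones_def)
    have "int (count_blocks (ones (Suc a) @ w) (Suc m) z r) =
        (if z \<le> r then int (count_blocks (ones a @ w) m z (r - z)) else 0) +
        int (count_blocks (ones (Suc a) @ w) m (Suc z) r)"
      unfolding ones by simp
    also have "\<dots> = coeff (monom 1 z * (monom 1 (a * z) * (q_binomial_poly m a * ?F)) +
        monom 1 (Suc a * Suc z) * (q_binomial_poly m (Suc a) * ?F)) r"
      unfolding Suc.IH using \<open>\<And>m z r. int (count_blocks (ones a @ w) m z r) = _ m z r\<close>
      by (simp add: coeff_monom_mult)
    also have "monom 1 z * (monom 1 (a * z) * (q_binomial_poly m a * ?F)) =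
        monom 1 (Suc a * z) * (q_binomial_poly m a * ?F)"
      by (simp add: mult_monom mult.assoc [symmetric])
    also have "monom 1 (Suc a * Suc z) * (q_binomial_poly m (Suc a) * ?F) =
        monom 1 (Suc a * z) * (monom 1 (Suc a) * q_binomial_poly m (Suc a) * ?F)"
      by (simp add: mult_monom mult.assoc [symmetric] add_ac)
    finally show ?case
      by (simp add: algebra_simps)
  qed
qed

lemma count_blocks_blocks:
  "int (count_blocks (blocks as) m z r) = coeff (multinomial_poly as (m + z)) r"
proof (induction as arbitrary: m z r)
  case (Cons a as)
  then show ?case
    using count_blocks_ones[of "blocks as" "multinomial_poly as" a "m + z" 0 r] by simp
qed (simp add: coeff_1)

lemma word_eq_ones_blocks: "\<exists>a as. w = ones a @ blocks as"
proof (induction w)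
  case Nil
  then show ?case by (intro exI[of _ 0] exI[of _ "[]"]) (simp add: ones_def)
next
  case (Cons b w)
  then obtain a as where w: "w = ones a @ blocks as" by blast
  show ?case
  proof (cases b)
    case True
    then show ?thesis using w by (intro exI[of _ "Suc a"] exI[of _ as]) (simp add: ones_def)
  next
    case False
    then show ?thesis using w by (intro exI[of _ 0] exI[of _ "a # as"]) (simp add: ones_def)
  qed
qed

lemma ones_blocks_inject: "ones a @ blocks as = ones b @ blocks bs \<longleftrightarrow> a = b \<and> as = bs"
  using concat_ones_inject[of "a # as" "b # bs"] by simp

lemma count_n_ones: "count_n (ones a @ w) n = count_n w (n + a)"
  by (induction a arbitrary: n) (simp_all add: ones_def)

lemma count_r_ones: "count_r (ones a @ w) n r = count_r w n (r + a)"
  by (induction a arbitrary: r) (simp_all add: ones_def)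

lemma count_n_eq_q_multinomial_fun: "count_n x 0 = q_multinomial_fun x"
proof -
  obtain n bs where x: "x = ones n @ blocks bs"
    using word_eq_ones_blocks by blast
  have enc: "encode n' r' as' = ones n' @ blocks (r' # as')" for n' r' as'
    by (simp add: encode_def)
  show ?thesis
  proof (cases "\<exists>r as. bs = r # as \<and> as \<noteq> []")
    case True
    then obtain r as where bs: "bs = r # as" "as \<noteq> []" by blast
    then have x_enc: "x = encode n r as" by (simp add: x enc)
    obtain a as' where as: "as = a # as'" using bs(2) by (cases as) auto
    have "count_n x 0 = count_blocks (blocks as) n 0 r"
      by (simp add: x bs as count_n_ones count_r_ones)
    then have c: "int (count_n x 0) = coeff (multinomial_poly as n) r"
      by (simp add: count_blocks_blocks)
    show ?thesis
    proof (cases "sum_list as = n")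
      case True
      have "int (q_multinomial_fun x) = q_coeff (to_fract (multinomial_poly as n)) r"
        unfolding to_fract_multinomial_poly[OF True] x_enc
        by (rule q_multinomial_fun_encode) fact+
      then show ?thesis using c by simp
    next
      case False
      then have "q_multinomial_fun x = 0"
        by (intro q_multinomial_fun_other) (auto simp: x_enc encode_inject)
      then show ?thesis using c False by (simp add: multinomial_poly_eq_0)
    qed
  next
    case False
    then have "q_multinomial_fun x = 0"
      by (intro q_multinomial_fun_other) (auto simp: x enc ones_blocks_inject simp del: concat.simps list.map)
    moreover have "count_n x 0 = 0"
      using False by (cases bs; cases "tl bs") (auto simp: x count_n_ones count_r_ones count_n_ones[of n "[]", simplified]
          count_r_ones[of _ "[]", simplified])
    ultimately show ?thesis by simp
  qed
qed

section \<open>A counter program for \<open>q\<close>-multinomial coefficients\<close>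

text \<open>
  The counters are numbered as follows: 0 is \<open>m\<close> (first used for reading \<open>n\<close>), 1 is \<open>r\<close>, 2 is
  \<open>z\<close>, and 3 is an auxiliary counter that preserves \<open>z\<close> while it is subtracted from \<open>r\<close>.
\<close>

datatype label =
    Begin | ReadN | CountN | ReadR | CountR
  | Scan | TakeLetter | Choose | SkipZ
  | SubZ | SubR | Save | Restore | RestoreZ
  | Merge | MergeM
  | CheckM | CheckZ | CheckR | Accept | Reject

instance label :: finite
proof
  have "l \<in> {Begin, ReadN, CountN, ReadR, CountR, Scan, TakeLetter, Choose, SkipZ, SubZ, SubR,
      Save, Restore, RestoreZ, Merge, MergeM, CheckM, CheckZ, CheckR, Accept, Reject}" for l
    by (cases l) simp_all
  then show "finite (UNIV :: label set)"
    by (rule finite_subset[OF subsetI]) simp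
qed

text \<open>
  \<open>ReadN\<close> and \<open>ReadR\<close> read \<open>n\<close> and \<open>r\<close> from the input. \<open>Scan\<close> is the main loop over the blocks; on
  the letter 1 of a block, one letter of the binary word is guessed in \<open>Choose\<close>. The loop at
  \<open>SubZ\<close> subtracts \<open>z\<close> from \<open>r\<close> and moves \<open>z\<close> to the auxiliary counter, and the loop at \<open>Restore\<close>
  moves it back. The loop at \<open>Merge\<close> adds \<open>z\<close> to \<open>m\<close> and clears \<open>z\<close>. \<open>CheckM\<close>, \<open>CheckZ\<close> and
  \<open>CheckR\<close> test that \<open>m\<close>, \<open>z\<close> and \<open>r\<close> are 0.
\<close>

fun program :: "label \<Rightarrow> label instr" where
  "program Begin = Setup ReadN"
| "program ReadN = Branch (\<lambda>s. case s of
     Letter b \<Rightarrow> {(MoveRight, if b then CountN else ReadR)} | _ \<Rightarrow> {})"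
| "program CountN = Incr 0 ReadN"
| "program ReadR = Branch (\<lambda>s. case s of
     Letter b \<Rightarrow> {(MoveRight, if b then CountR else Scan)} | _ \<Rightarrow> {})"
| "program CountR = Incr 1 ReadR"
| "program Scan = Branch (\<lambda>s. case s of
     Letter b \<Rightarrow> {if b then (Stay, TakeLetter) else (MoveRight, Merge)}
   | RightEnd \<Rightarrow> {(Stay, CheckM)}
   | LeftEnd \<Rightarrow> {})"
| "program TakeLetter = Decr 0 Choose Reject"
| "program Choose = Branch (\<lambda>_. {(MoveRight, SubZ), (Stay, SkipZ)})"
| "program SkipZ = Incr 2 Scan"
| "program SubZ = Decr 2 SubR Restore"
| "program SubR = Decr 1 Save Reject"
| "program Save = Incr 3 SubZ"
| "program Restore = Decr 3 RestoreZ Scan"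
| "program RestoreZ = Incr 2 Restore"
| "program Merge = Decr 2 MergeM Scan"
| "program MergeM = Incr 0 Merge"
| "program CheckM = Decr 0 Reject CheckZ"
| "program CheckZ = Decr 2 Reject CheckR"
| "program CheckR = Decr 1 Reject Accept"
| "program Accept = Branch (\<lambda>_. {})"
| "program Reject = Branch (\<lambda>_. {})"

lemma input_symbol_append:
  "input_symbol (u @ w) (Suc (length u)) = (case w of [] \<Rightarrow> RightEnd | b # _ \<Rightarrow> Letter b)"
  by (cases w) (auto simp: input_symbol_def nth_append)

context
  fixes x :: "bool list" and L :: nat
  assumes bound: "length x < 2 ^ L"
begin

interpretation counter_program 4 program Begin "{Accept}" x L .

lemma computes_Reject: "length vs = 4 \<Longrightarrow> computes Reject i vs 0"
  using computes_halt[of Reject "\<lambda>_. {}" vs i] by simp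

lemma computes_Restore:
  assumes "i \<le> Suc (length x)" "z + t \<le> length x" "computes Scan i [m, r, z + t, 0] v"
  shows "computes Restore i [m, r, z, t] v"
  using assms(2,3)
proof (induction t arbitrary: z)
  case 0
  then show ?case
    using assms(1) by (intro computes_Decr_0[of Restore 3 RestoreZ Scan]) simp_all
next
  case (Suc t)
  have "computes RestoreZ i [m, r, z, t] v"
    using Suc assms(1) bound
    by (intro computes_Incr[of RestoreZ 2 Restore]) (simp_all add: numeral_eq_Suc)
  then show ?case
    using assms(1)
    by (intro computes_Decr_Suc[of Restore 3 RestoreZ Scan i _ t]) (simp_all add: numeral_eq_Suc)
qed

lemma computes_SubZ:
  assumes i: "i \<le> Suc (length x)" and "z + t \<le> length x"
    and "z \<le> r \<Longrightarrow> computes Scan i [m, r - z, z + t, 0] v"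
  shows "computes SubZ i [m, r, z, t] (if z \<le> r then v else 0)"
  using assms(2,3)
proof (induction z arbitrary: r t)
  case 0
  then have "computes Restore i [m, r, 0, t] v"
    using i by (intro computes_Restore) simp_all
  then show ?case
    using i by (intro computes_Decr_0[of SubZ 2 SubR Restore]) (simp_all add: numeral_eq_Suc)
next
  case (Suc z)
  have "computes SubR i [m, r, z, t] (if Suc z \<le> r then v else 0)"
  proof (cases r)
    case 0
    then show ?thesis
      using i computes_Reject
      by (intro computes_Decr_0[of SubR 1 Save Reject]) (simp_all add: numeral_eq_Suc)
  next
    case r: (Suc r')
    have "computes SubZ i [m, r', z, Suc t] (if z \<le> r' then v else 0)"
      using Suc r by (intro Suc.IH) simp_all
    then have "computes Save i [m, r', z, t] (if z \<le> r' then v else 0)"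
      using i Suc.prems bound by (intro computes_Incr[of Save 3 SubZ]) (simp_all add: numeral_eq_Suc)
    then show ?thesis
      using i r
      by (intro computes_Decr_Suc[of SubR 1 Save Reject i _ r']) (simp_all add: numeral_eq_Suc)
  qed
  then show ?case
    using i by (intro computes_Decr_Suc[of SubZ 2 SubR Restore i _ z]) (simp_all add: numeral_eq_Suc)
qed

lemma computes_Merge:
  assumes "i \<le> Suc (length x)" "m + z \<le> length x" "computes Scan i [m + z, r, 0, t] v"
  shows "computes Merge i [m, r, z, t] v"
  using assms(2,3)
proof (induction z arbitrary: m)
  case 0
  then show ?case
    using assms(1) by (intro computes_Decr_0[of Merge 2 MergeM Scan]) (simp_all add: numeral_eq_Suc)
next
  case (Suc z)
  have "computes MergeM i [m, r, z, t] v"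
    using Suc assms(1) bound
    by (intro computes_Incr[of MergeM 0 Merge]) (simp_all add: numeral_eq_Suc)
  then show ?case
    using assms(1)
    by (intro computes_Decr_Suc[of Merge 2 MergeM Scan i _ z]) (simp_all add: numeral_eq_Suc)
qed

lemma computes_CheckM:
  assumes i: "i \<le> Suc (length x)"
  shows "computes CheckM i [m, r, z, t] (if m = 0 \<and> z = 0 \<and> r = 0 then 1 else 0)"
proof -
  have accept: "computes Accept i [m, r, z, t] 1" for m r z t
    using computes_halt[of Accept "\<lambda>_. {}" "[m, r, z, t]" i] by simp
  have r: "computes CheckR i [m, r, z, t] (if r = 0 then 1 else 0)" for m r z t
    using i accept computes_Reject
    by (cases r) (auto intro: computes_Decr_0[of CheckR 1 Reject Accept]
      computes_Decr_Suc[of CheckR 1 Reject Accept])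
  have z: "computes CheckZ i [m, r, z, t] (if z = 0 \<and> r = 0 then 1 else 0)" for m r z t
  proof (cases z)
    case 0
    have "computes CheckZ i [m, r, z, t] (if r = 0 then 1 else 0)"
      by (rule computes_Decr_0[of CheckZ 2 Reject CheckR]) (use i r 0 in simp_all)
    then show ?thesis using 0 by simp
  next
    case (Suc z')
    have "computes CheckZ i [m, r, z, t] 0"
      by (rule computes_Decr_Suc[of CheckZ 2 Reject CheckR i _ z'])
        (use i computes_Reject Suc in simp_all)
    then show ?thesis using Suc by simp
  qed
  show ?thesis
    using i z[of m r z t] computes_Reject
    by (cases m) (auto intro: computes_Decr_0[of CheckM 0 Reject CheckZ]
      computes_Decr_Suc[of CheckM 0 Reject CheckZ])
qed

lemma computes_Scan:
  assumes "x = u @ w" "m + z \<le> length x" "r \<le> length x"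
  shows "computes Scan (Suc (length u)) [m, r, z, 0] (count_blocks w m z r)"
  using assms
proof (induction w m z r arbitrary: u rule: count_blocks.induct)
  case (1 m z r)
  then have "computes CheckM (Suc (length u)) [m, r, z, 0] (count_blocks [] m z r)"
    using computes_CheckM by simp
  then show ?case
    using 1 input_symbol_append[of u "[]"]
    by (intro computes_Branch[of Scan _ Stay CheckM]) simp_all
next
  case (2 w m z r)
  have "computes Scan (Suc (Suc (length u))) [m + z, r, 0, 0] (count_blocks w (m + z) 0 r)"
    using "2.IH"[of "u @ [False]"] "2.prems" by simp
  then have "computes Merge (Suc (Suc (length u))) [m, r, z, 0] (count_blocks w (m + z) 0 r)"
    using "2.prems" by (intro computes_Merge) simp_all
  then show ?case
    using "2.prems" input_symbol_append[of u "False # w"]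
    by (intro computes_Branch[of Scan _ MoveRight Merge]) simp_all
next
  case (3 w z r)
  have "computes TakeLetter (Suc (length u)) [0, r, z, 0] 0"
    using 3 computes_Reject by (intro computes_Decr_0[of TakeLetter 0 Choose Reject]) simp_all
  then show ?case
    using 3 input_symbol_append[of u "True # w"]
    by (intro computes_Branch[of Scan _ Stay TakeLetter]) simp_all
next
  case (4 w m z r)
  let ?i = "Suc (length u)"
  have "computes Scan (Suc ?i) [m, r - z, z, 0] (count_blocks w m z (r - z))" if "z \<le> r"
    using "4.IH"(1)[OF that, of "u @ [True]"] "4.prems" by simp
  then have one: "computes SubZ (Suc ?i) [m, r, z, 0]
      (if z \<le> r then count_blocks w m z (r - z) else 0)"
    using "4.prems" by (intro computes_SubZ) simp_all
  have "computes Scan ?i [m, r, Suc z, 0] (count_blocks (True # w) m (Suc z) r)"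
    using "4.IH"(2) "4.prems" by simp
  then have zero: "computes SkipZ ?i [m, r, z, 0] (count_blocks (True # w) m (Suc z) r)"
    using "4.prems" bound by (intro computes_Incr[of SkipZ 2 Scan]) (simp_all add: numeral_eq_Suc)
  have "computes Choose ?i [m, r, z, 0] (count_blocks (True # w) (Suc m) z r)"
    using one zero "4.prems" unfolding count_blocks.simps
    by (intro computes_Branch2[of Choose _ MoveRight SubZ Stay SkipZ]) simp_all
  then have "computes TakeLetter ?i [Suc m, r, z, 0] (count_blocks (True # w) (Suc m) z r)"
    using "4.prems" by (intro computes_Decr_Suc[of TakeLetter 0 Choose Reject]) simp_all
  then show ?case
    using "4.prems" input_symbol_append[of u "True # w"]
    by (intro computes_Branch[of Scan _ Stay TakeLetter]) simp_all
qed

lemma computes_ReadR: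
  assumes "x = u @ w" "n \<le> length x" "r \<le> length u"
  shows "computes ReadR (Suc (length u)) [n, r, 0, 0] (count_r w n r)"
  using assms
proof (induction w n r arbitrary: u rule: count_r.induct)
  case (1 n r)
  then show ?case
    using computes_halt[of ReadR _ "[n, r, 0, 0]" "Suc (length u)"] input_symbol_append[of u "[]"]
    by simp
next
  case (2 w n r)
  have "computes ReadR (Suc (Suc (length u))) [n, Suc r, 0, 0] (count_r w n (Suc r))"
    using "2.IH"[of "u @ [True]"] "2.prems" by simp
  then have "computes CountR (Suc (Suc (length u))) [n, r, 0, 0] (count_r w n (Suc r))"
    using "2.prems" bound by (intro computes_Incr[of CountR 1 ReadR]) simp_all
  then show ?case
    using "2.prems" input_symbol_append[of u "True # w"]
    by (intro computes_Branch[of ReadR _ MoveRight CountR]) simp_all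
next
  case (3 w n r)
  have "computes Scan (Suc (Suc (length u))) [n, r, 0, 0] (count_blocks w n 0 r)"
    using computes_Scan[of "u @ [False]" w n 0 r] 3 by simp
  then show ?case
    using 3 input_symbol_append[of u "False # w"]
    by (intro computes_Branch[of ReadR _ MoveRight Scan]) simp_all
qed

lemma computes_ReadN:
  assumes "x = u @ w" "n \<le> length u"
  shows "computes ReadN (Suc (length u)) [n, 0, 0, 0] (count_n w n)"
  using assms
proof (induction w n arbitrary: u rule: count_n.induct)
  case (1 n)
  then show ?case
    using computes_halt[of ReadN _ "[n, 0, 0, 0]" "Suc (length u)"] input_symbol_append[of u "[]"]
    by simp
next
  case (2 w n)
  have "computes ReadN (Suc (Suc (length u))) [Suc n, 0, 0, 0] (count_n w (Suc n))"
    using "2.IH"[of "u @ [True]"] "2.prems" by simp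
  then have "computes CountN (Suc (Suc (length u))) [n, 0, 0, 0] (count_n w (Suc n))"
    using "2.prems" bound by (intro computes_Incr[of CountN 0 ReadN]) simp_all
  then show ?case
    using "2.prems" input_symbol_append[of u "True # w"]
    by (intro computes_Branch[of ReadN _ MoveRight CountN]) simp_all
next
  case (3 w n)
  have "computes ReadR (Suc (Suc (length u))) [n, 0, 0, 0] (count_r w n 0)"
    using computes_ReadR[of "u @ [False]" w n 0] 3 by simp
  then show ?case
    using 3 input_symbol_append[of u "False # w"]
    by (intro computes_Branch[of ReadN _ MoveRight ReadR]) simp_all
qed

lemma path_count_program:
  "path_count (compile 4 program Begin {Accept}) x (L + 2)
     (init_config (compile 4 program Begin {Accept})) (count_n x 0)"
proof (rule count_init)
  show "program Begin = Setup ReadN" by simp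
  show "computes ReadN 1 (replicate 4 0) (count_n x 0)"
    using computes_ReadN[of "[]" x 0] by (simp add: numeral_eq_Suc)
qed

end

lemma less_power_floorlog: "n < 2 ^ floorlog 2 n"
  using floorlog_bounds[of n 2] by (cases "n = 0") auto

lemma floorlog_bigo_ln: "(\<lambda>n. real (floorlog 2 n + 2)) \<in> O(\<lambda>n. ln (real n))"
proof -
  have "real (floorlog 2 n + 2) \<le> log 2 (real n) + 3" if "n > 0" for n
    using that by (simp add: floorlog_def)
  then have "eventually (\<lambda>n. norm (real (floorlog 2 n + 2)) \<le> norm (log 2 (real n) + 3)) at_top"
    by (intro eventually_mono[OF eventually_gt_at_top[of "0::nat"]]) fastforce
  then have "(\<lambda>n. real (floorlog 2 n + 2)) \<in> O(\<lambda>n. log 2 (real n) + 3)"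
    by (rule landau_o.big_mono)
  also have "(\<lambda>n. log 2 (real n) + 3) \<in> O(\<lambda>n. ln (real n))"
    unfolding log_def by real_asymp
  finally show ?thesis .
qed

theorem corollary5p5:
  shows "q_multinomial_fun \<in> sharpL"
proof -
  let ?M = "compile 4 program Begin {Accept}"
  have count: "path_count ?M x (floorlog 2 (length x) + 2) (init_config ?M) (q_multinomial_fun x)"
    for x
    using path_count_program[OF less_power_floorlog] by (simp add: count_n_eq_q_multinomial_fun)
  show ?thesis
    unfolding sharpL_def
    using wf_compile path_count_init[OF count] floorlog_bigo_ln
    by (intro CollectI exI[of _ ?M] conjI allI exI[of _ "\<lambda>n. floorlog 2 n + 2"]) auto
qed

end
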